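(* Let $I\subseteq\mathbb{R}$ be an interval, $c\colon I\to\mathbb{R}^2$ a $C^3$ affine unit speed curve with affine curvature $\kappa$, and let $a\in I$. For any point $p_0\in\mathbb{R}^2$ the area function $$A(s)=A_{c,a,p_0}(s)=\frac12\int_a^s(c(\sigma)-p_0)\wedge c'(\sigma)\,d\sigma$$ satisfies the third order differential equation $$A'''+\kappa A'=\frac12$$ on $I$ with initial conditions $$A(a)=0,\qquad A'(a)=\frac12(c(a)-p_0)\wedge c'(a),\qquad A''(a)=\frac12(c(a)-p_0)\wedge c''(a).$$
   Context: For $v=(v_1,v_2),w=(w_1,w_2)\in\mathbb{R}^2$ put $v\wedge w=v_1w_2-v_2w_1$. The curve $c$ has affine unit speed if $c'(s)\wedge c''(s)=1$ for all $s$, and its affine curvature is the function $\kappa$ with $c'''(s)=-\kappa(s)c'(s)$. Geometrically $A_{c,a,p_0}(s)$ is the signed area bounded by $c|_{[a,s]}$ and the segments $\overline{p_0c(a)}$ and $\overline{p_0c(s)}$; the integral formula is its precise definition. *)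

theory Defs
  imports "HOL-Analysis.Analysis"
begin

text \<open>Derivatives are taken within the domain \<open>I\<close>, so they are one-sided at end points
  that belong to \<open>I\<close>, and values outside \<open>I\<close> are irrelevant at points of \<open>I\<close>.\<close>

primrec deriv_within :: "real set \<Rightarrow> nat \<Rightarrow> (real \<Rightarrow> 'a::real_normed_vector) \<Rightarrow> real \<Rightarrow> 'a" where
  "deriv_within I 0 f = f"
| "deriv_within I (Suc k) f = (\<lambda>s. vector_derivative (deriv_within I k f) (at s within I))"

definition times_differentiable_on ::
    "nat \<Rightarrow> (real \<Rightarrow> 'a::real_normed_vector) \<Rightarrow> real set \<Rightarrow> bool" where
  "times_differentiable_on k f I \<longleftrightarrow> (\<forall>j<k. deriv_within I j f differentiable_on I)"

definition Ck_on :: "nat \<Rightarrow> (real \<Rightarrow> 'a::real_normed_vector) \<Rightarrow> real set \<Rightarrow> bool" where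
  "Ck_on k f I \<longleftrightarrow> times_differentiable_on k f I \<and> continuous_on I (deriv_within I k f)"

definition wedge :: "real ^ 2 \<Rightarrow> real ^ 2 \<Rightarrow> real" where
  "wedge v w = v $ 1 * w $ 2 - v $ 2 * w $ 1"

definition affine_unit_speed_on :: "real set \<Rightarrow> (real \<Rightarrow> real ^ 2) \<Rightarrow> bool" where
  "affine_unit_speed_on I c \<longleftrightarrow>
     (\<forall>s\<in>I. wedge (deriv_within I 1 c s) (deriv_within I 2 c s) = 1)"

text \<open>For a \<open>C\<^sup>3\<close> affine unit speed curve the description below is well defined at every point of
  \<open>I\<close>: differentiating \<open>c' \<and> c'' = 1\<close> gives \<open>c' \<and> c''' = 0\<close>, and \<open>c'\<close> does not vanish.\<close>

definition affine_curvature :: "real set \<Rightarrow> (real \<Rightarrow> real ^ 2) \<Rightarrow> real \<Rightarrow> real" where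
  "affine_curvature I c s =
     (THE k. deriv_within I 3 c s = - (k *\<^sub>R deriv_within I 1 c s))"

text \<open>The interval integral is oriented: it changes sign when \<open>s < a\<close>.\<close>

definition area_function ::
    "real set \<Rightarrow> (real \<Rightarrow> real ^ 2) \<Rightarrow> real \<Rightarrow> real ^ 2 \<Rightarrow> real \<Rightarrow> real" where
  "area_function I c a p0 s =
     1 / 2 * (LBINT \<sigma>=ereal a..ereal s. wedge (c \<sigma> - p0) (deriv_within I 1 c \<sigma>))"

end

theory Submission
  imports Defs
begin

text \<open>The integrand of the area function is continuous, so the fundamental theorem of calculus
  gives \<open>A' = 1/2 (c - p0) \<and> c'\<close>. The wedge product is bilinear and alternating; hence the product
  rule gives \<open>A'' = 1/2 (c - p0) \<and> c''\<close>, as \<open>c' \<and> c' = 0\<close>, and then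
  \<open>A''' = 1/2 (c' \<and> c'' + (c - p0) \<and> c''')\<close>. Affine unit speed and \<open>c''' = - \<kappa> c'\<close> turn the right
  side into \<open>1/2 - \<kappa> A'\<close>, which is the differential equation.

  Two points need care. On an interval of arbitrary shape, derivatives are relative to \<open>I\<close>, while
  the fundamental theorem concerns compact intervals; the lemma \<open>interval_locally_compact_interval\<close>
  links the two, as near a given point \<open>I\<close> looks like a compact subinterval.
  Moreover \<open>affine_curvature\<close> is a definite description, so existence and uniqueness of the
  proportionality factor have to be shown: \<open>c'\<close> and \<open>c''\<close> form a basis of the plane, and
  differentiating \<open>c' \<and> c'' = 1\<close> shows that the \<open>c''\<close>-coordinate of \<open>c'''\<close> vanishes
  (\<open>affine_curvature_eq\<close>).\<close>

section \<open>Derivatives and integrals on an interval\<close>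

lemma at_within_interval_neq_bot:
  fixes I :: "real set"
  assumes "is_interval I" and "interior I \<noteq> {}" and "s \<in> I"
  shows "at s within I \<noteq> bot"
proof -
  have "I \<noteq> {s}"
    using assms(2) by auto
  then have "s islimpt I"
    using assms connected_imp_perfect is_interval_connected_1 by blast
  then show ?thesis
    by (simp add: trivial_limit_within)
qed

lemma times_differentiable_on_has_vector_derivative:
  assumes "times_differentiable_on n f I" and "k < n" and "s \<in> I"
  shows "(deriv_within I k f has_vector_derivative deriv_within I (Suc k) f s) (at s within I)"
  using assms
  by (simp add: times_differentiable_on_def differentiable_on_def vector_derivative_works)

text \<open>Iterated derivatives within \<open>I\<close> can be computed one order at a time from formulas that are
  valid only on \<open>I\<close>. The order \<open>m\<close> is a separate variable so that it may be a numeral.\<close>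

lemma deriv_within_step:
  fixes I :: "real set"
  assumes I: "is_interval I" "interior I \<noteq> {}"
    and m: "m = Suc k"
    and eq: "\<And>s. s \<in> I \<Longrightarrow> deriv_within I k f s = F s"
    and der: "\<And>s. s \<in> I \<Longrightarrow> (F has_vector_derivative F' s) (at s within I)"
  shows "deriv_within I k f differentiable_on I"
    and "\<And>s. s \<in> I \<Longrightarrow> deriv_within I m f s = F' s"
proof -
  have *: "(deriv_within I k f has_vector_derivative F' s) (at s within I)" if "s \<in> I" for s
    using has_vector_derivative_transform[OF that eq der[OF that]] .
  show "deriv_within I k f differentiable_on I"
    unfolding differentiable_on_def using * differentiableI_vector by blast
  show "deriv_within I m f s = F' s" if "s \<in> I" for s
    using vector_derivative_within[OF at_within_interval_neq_bot[OF I that] *[OF that]] m by simp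
qed

text \<open>If \<open>s\<close> is not the right end point of \<open>I\<close>, the compact interval can be made to extend
  beyond \<open>s\<close> to the right, and likewise to the left; then it contains all points of \<open>I\<close> that are
  close to \<open>s\<close>, so both sets define the same punctured neighbourhoods of \<open>s\<close>.\<close>

lemma interval_locally_compact_interval:
  fixes I :: "real set"
  assumes I: "is_interval I" and "a \<in> I" and "s \<in> I"
  obtains u v where "{u..v} \<subseteq> I" and "a \<in> {u..v}" and "s \<in> {u..v}"
    and "at s within I = at s within {u..v}"
proof -
  have "\<exists>v\<in>I. a \<le> v \<and> s \<le> v \<and> (s < v \<or> I \<subseteq> {..s})"
  proof (cases "I \<subseteq> {..s}")
    case True
    then show ?thesis using assms by auto
  next
    case False
    then obtain w where "w \<in> I" "s < w" by (auto simp: subset_eq not_le)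
    then show ?thesis using \<open>a \<in> I\<close> by (intro bexI[of _ "max a w"]) (auto simp: max_def)
  qed
  then obtain v where v: "v \<in> I" "a \<le> v" "s \<le> v" "s < v \<or> I \<subseteq> {..s}" by blast
  have "\<exists>u\<in>I. u \<le> a \<and> u \<le> s \<and> (u < s \<or> I \<subseteq> {s..})"
  proof (cases "I \<subseteq> {s..}")
    case True
    then show ?thesis using assms by auto
  next
    case False
    then obtain w where "w \<in> I" "w < s" by (auto simp: subset_eq not_le)
    then show ?thesis using \<open>a \<in> I\<close> by (intro bexI[of _ "min a w"]) (auto simp: min_def)
  qed
  then obtain u where u: "u \<in> I" "u \<le> a" "u \<le> s" "u < s \<or> I \<subseteq> {s..}" by blast
  have sub: "{u..v} \<subseteq> I"
    using mem_is_interval_1_I[OF I u(1) v(1)] by auto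
  \<comment> \<open>An open set around \<open>s\<close>, bounded only on those sides where \<open>I\<close> continues past \<open>s\<close>.\<close>
  define S where "S = (if s < v then {..<v} else UNIV) \<inter> (if u < s then {u<..} else UNIV)"
  have "x \<le> v" if "x \<in> I" "x \<in> S" for x
    using that v(3,4) by (cases "s < v") (auto simp: S_def)
  moreover have "u \<le> x" if "x \<in> I" "x \<in> S" for x
    using that u(3,4) by (cases "u < s") (auto simp: S_def)
  ultimately have "I \<inter> S \<subseteq> {u..v}"
    by auto
  have "at s within I = at s within {u..v}"
  proof (rule at_within_nhd)
    show "s \<in> S" and "open S"
      by (auto simp: S_def)
    show "I \<inter> S - {s} = {u..v} \<inter> S - {s}"
      using \<open>I \<inter> S \<subseteq> {u..v}\<close> sub by blast
  qed
  moreover have "a \<in> {u..v}" "s \<in> {u..v}"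
    using u(2,3) v(2,3) by simp_all
  ultimately show ?thesis
    using that sub by blast
qed

lemma interval_integral_has_vector_derivative_within:
  fixes f :: "real \<Rightarrow> 'a::euclidean_space"
  assumes "is_interval I" and "continuous_on I f" and "a \<in> I" and "s \<in> I"
  shows "((\<lambda>s. LBINT x=ereal a..ereal s. f x) has_vector_derivative f s) (at s within I)"
proof -
  obtain u v where uv: "{u..v} \<subseteq> I" "a \<in> {u..v}" "s \<in> {u..v}"
    "at s within I = at s within {u..v}"
    using interval_locally_compact_interval assms(1,3,4) .
  then show ?thesis
    using interval_integral_FTC2[of u a v f s] continuous_on_subset[OF assms(2)] by auto
qed

section \<open>The wedge product and the affine curvature\<close>

lemma bounded_bilinear_wedge: "bounded_bilinear wedge"
proof
  show "\<exists>K. \<forall>a b. norm (wedge a b) \<le> norm a * norm b * K"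
  proof (intro exI[of _ 2] allI)
    fix a b :: "real ^ 2"
    have "\<bar>a $ i * b $ j\<bar> \<le> norm a * norm b" for i j
      using component_le_norm_cart[of a i] component_le_norm_cart[of b j]
      by (simp add: abs_mult mult_mono)
    from this[of 1 2] this[of 2 1] show "norm (wedge a b) \<le> norm a * norm b * 2"
      unfolding wedge_def real_norm_def by linarith
  qed
qed (simp_all add: wedge_def algebra_simps)

lemma wedge_self [simp]: "wedge x x = 0"
  by (simp add: wedge_def)

lemmas has_vector_derivative_wedge =
  bounded_bilinear.has_vector_derivative[OF bounded_bilinear_wedge]

text \<open>Cramer's rule in the basis \<open>x\<close>, \<open>y\<close>, whose determinant is the given wedge product.\<close>

lemma wedge_basis_expansion:
  assumes "wedge x y = 1"
  shows "z = wedge z y *\<^sub>R x + wedge x z *\<^sub>R y"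
proof -
  have "wedge x y *\<^sub>R z = wedge z y *\<^sub>R x + wedge x z *\<^sub>R y"
    by (simp add: vec_eq_iff forall_2 wedge_def algebra_simps)
  then show ?thesis
    by (simp add: assms)
qed

text \<open>Since \<open>c' \<and> c''\<close> is constant, its derivative \<open>c' \<and> c'''\<close> vanishes, so the expansion of
  \<open>c'''\<close> in the basis \<open>c'\<close>, \<open>c''\<close> reduces to its first term. The factor is unique as \<open>c'\<close> is
  nonzero.\<close>

lemma affine_curvature_eq:
  assumes I: "is_interval I" "interior I \<noteq> {}"
    and c: "times_differentiable_on 3 c I"
    and unit: "affine_unit_speed_on I c"
    and s: "s \<in> I"
  shows "deriv_within I 3 c s = - (affine_curvature I c s *\<^sub>R deriv_within I 1 c s)"
proof -
  let ?c1 = "deriv_within I 1 c" and ?c2 = "deriv_within I 2 c" and ?c3 = "deriv_within I 3 c"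
  have w: "wedge (?c1 t) (?c2 t) = 1" if "t \<in> I" for t
    using unit that by (simp add: affine_unit_speed_on_def)
  have d1: "(?c1 has_vector_derivative ?c2 s) (at s within I)"
    using times_differentiable_on_has_vector_derivative[OF c, of 1] s by (simp add: numeral_2_eq_2)
  have d2: "(?c2 has_vector_derivative ?c3 s) (at s within I)"
    using times_differentiable_on_has_vector_derivative[OF c, of 2] s by (simp add: eval_nat_numeral)
  have "((\<lambda>t. wedge (?c1 t) (?c2 t)) has_vector_derivative wedge (?c1 s) (?c3 s)) (at s within I)"
    using has_vector_derivative_wedge[OF d1 d2] by simp
  moreover have "((\<lambda>t. wedge (?c1 t) (?c2 t)) has_vector_derivative 0) (at s within I)"
    by (rule has_vector_derivative_transform[OF s w]) auto
  ultimately have "wedge (?c1 s) (?c3 s) = 0"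
    using vector_derivative_unique_within[OF at_within_interval_neq_bot[OF I s]] by blast
  then have "?c3 s = - ((- wedge (?c3 s) (?c2 s)) *\<^sub>R ?c1 s)"
    using wedge_basis_expansion[OF w[OF s], of "?c3 s"] by simp
  moreover have "?c1 s \<noteq> 0"
    using w[OF s] by (auto simp: wedge_def)
  ultimately have "\<exists>!k. ?c3 s = - (k *\<^sub>R ?c1 s)"
    by (metis neg_equal_iff_equal scaleR_cancel_right)
  then show ?thesis
    unfolding affine_curvature_def by (rule theI')
qed

section \<open>The differential equation of the area function\<close>

theorem theorem2p2:
  fixes I :: "real set" and c :: "real \<Rightarrow> real ^ 2" and \<kappa> :: "real \<Rightarrow> real"
    and a :: real and p0 :: "real ^ 2" and A :: "real \<Rightarrow> real"
  assumes "is_interval I" and "interior I \<noteq> {}"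
    and "Ck_on 3 c I"
    and "affine_unit_speed_on I c"
    and "a \<in> I"
  defines "\<kappa> \<equiv> affine_curvature I c"
    and "A \<equiv> area_function I c a p0"
  shows "times_differentiable_on 3 A I
    \<and> (\<forall>s\<in>I. deriv_within I 3 A s + \<kappa> s * deriv_within I 1 A s = 1 / 2)
    \<and> A a = 0
    \<and> deriv_within I 1 A a = 1 / 2 * wedge (c a - p0) (deriv_within I 1 c a)
    \<and> deriv_within I 2 A a = 1 / 2 * wedge (c a - p0) (deriv_within I 2 c a)"
proof -
  note I = assms(1,2)
  have c: "times_differentiable_on 3 c I"
    using assms(3) by (simp add: Ck_on_def)
  let ?c1 = "deriv_within I 1 c" and ?c2 = "deriv_within I 2 c" and ?c3 = "deriv_within I 3 c"
  have d0: "((\<lambda>t. c t - p0) has_vector_derivative ?c1 s) (at s within I)" if "s \<in> I" for s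
    using times_differentiable_on_has_vector_derivative[OF c, of 0] that
    by (auto intro!: derivative_eq_intros)
  have d1: "(?c1 has_vector_derivative ?c2 s) (at s within I)" if "s \<in> I" for s
    using times_differentiable_on_has_vector_derivative[OF c, of 1] that
    by (simp add: numeral_2_eq_2)
  have d2: "(?c2 has_vector_derivative ?c3 s) (at s within I)" if "s \<in> I" for s
    using times_differentiable_on_has_vector_derivative[OF c, of 2] that
    by (simp add: eval_nat_numeral)
  define F1 where "F1 s = 1 / 2 * wedge (c s - p0) (?c1 s)" for s
  define F2 where "F2 s = 1 / 2 * wedge (c s - p0) (?c2 s)" for s
  define F3 where "F3 s = 1 / 2 * (wedge (c s - p0) (?c3 s) + 1)" for s
  have unit: "wedge (?c1 s) (?c2 s) = 1" if "s \<in> I" for s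
    using assms(4) that by (simp add: affine_unit_speed_on_def)
  note half = bounded_linear.has_vector_derivative[OF bounded_linear_mult_right[of "1/2::real"]]
  have w1: "((\<lambda>s. wedge (c s - p0) (?c1 s)) has_vector_derivative wedge (c s - p0) (?c2 s))
      (at s within I)" if "s \<in> I" for s
    using has_vector_derivative_wedge[OF d0 d1, OF that that] by simp
  have w2: "((\<lambda>s. wedge (c s - p0) (?c2 s)) has_vector_derivative wedge (c s - p0) (?c3 s) + 1)
      (at s within I)" if "s \<in> I" for s
    using has_vector_derivative_wedge[OF d0 d2, OF that that] unit[OF that] by simp
  have cont: "continuous_on I (\<lambda>s. wedge (c s - p0) (?c1 s))"
    using w1 has_vector_derivative_continuous continuous_on_eq_continuous_within by blast
  have A0: "(A has_vector_derivative F1 s) (at s within I)" if "s \<in> I" for s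
    unfolding A_def area_function_def F1_def
    by (rule half[OF interval_integral_has_vector_derivative_within
          [OF I(1) cont \<open>a \<in> I\<close> that]])
  have A1: "(F1 has_vector_derivative F2 s) (at s within I)" if "s \<in> I" for s
    unfolding F1_def F2_def by (rule half[OF w1[OF that]])
  have A2: "(F2 has_vector_derivative F3 s) (at s within I)" if "s \<in> I" for s
    unfolding F2_def F3_def by (rule half[OF w2[OF that]])
  have e0: "deriv_within I 0 A s = A s" for s
    by simp
  have D0: "deriv_within I 0 A differentiable_on I"
    by (rule deriv_within_step(1)[OF I refl e0 A0])
  have e1: "deriv_within I 1 A s = F1 s" if "s \<in> I" for s
    by (rule deriv_within_step(2)[OF I _ e0 A0 that]) simp_all
  have D1: "deriv_within I 1 A differentiable_on I"
    by (rule deriv_within_step(1)[OF I refl e1 A1])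
  have e2: "deriv_within I 2 A s = F2 s" if "s \<in> I" for s
    by (rule deriv_within_step(2)[OF I _ e1 A1 that]) simp_all
  have D2: "deriv_within I 2 A differentiable_on I"
    by (rule deriv_within_step(1)[OF I refl e2 A2])
  have e3: "deriv_within I 3 A s = F3 s" if "s \<in> I" for s
    by (rule deriv_within_step(2)[OF I _ e2 A2 that]) simp_all
  have "times_differentiable_on 3 A I"
    unfolding times_differentiable_on_def
  proof (intro allI impI)
    fix j :: nat
    assume "j < 3"
    then consider "j = 0" | "j = 1" | "j = 2" by linarith
    then show "deriv_within I j A differentiable_on I"
      using D0 D1 D2 by cases blast+
  qed
  moreover have "deriv_within I 3 A s + \<kappa> s * deriv_within I 1 A s = 1 / 2" if "s \<in> I" for s
  proof -
    have "?c3 s = - (\<kappa> s *\<^sub>R ?c1 s)"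
      unfolding \<kappa>_def by (rule affine_curvature_eq[OF I c assms(4) that])
    then have "wedge (c s - p0) (?c3 s) = - (\<kappa> s * wedge (c s - p0) (?c1 s))"
      by (simp add: wedge_def algebra_simps)
    then show ?thesis
      using e1[OF that] e3[OF that] by (simp add: F1_def F3_def algebra_simps)
  qed
  moreover have "A a = 0"
    by (simp add: A_def area_function_def)
  ultimately show ?thesis
    using e1[OF \<open>a \<in> I\<close>] e2[OF \<open>a \<in> I\<close>] by (simp add: F1_def F2_def)
qed

end
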